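(* Let $A\in\mathbb{R}^{n\times d}$ be a nonzero matrix, let $f(x)=\frac1{2n}\|Ax-b\|_2^2$, and let $K$ be a positive integer dividing $n$. Then for any possible partition $\bar S=[S_1,\dots,S_K]$ of $[n]=\{1,\dots,n\}$ into $K$ disjoint subsets of equal size $m=n/K$, the Stochastic Acceleration factor satisfies $$\Upsilon(A,\bar S,K)\;\le\;\frac{\sigma\left(A^TA,1\right)}{\sigma\left(A^TA,\left\lfloor n-\frac nK+1\right\rfloor\right)} .$$
   Context: $\sigma(H,k)$ denotes the $k$-th largest eigenvalue of a symmetric matrix $H\in\mathbb{R}^{d\times d}$, with the convention $\sigma(H,k)=0$ for $k>d$; when the denominator on the right-hand side is zero the right-hand side is read as $+\infty$. $\|A\|$ is the spectral norm of $A$. Let $S^k$ be the row-subsampling operator supported on $S_k$ (so $S^kA$ is the submatrix of $A$ with rows indexed by $S_k$), and $f_{S_k}(x)=\frac{K}{2n}\|S^kAx-S^kb\|_2^2$, so that $f=\frac1K\sum_{k=1}^Kf_{S_k}$. $L_f$ is the gradient-Lipschitz (smoothness) constant of $f$ and $L_b$ is the common gradient-Lipschitz constant of the $f_{S_k}$, i.e. in the least-squares setting $$L_f=\frac1n\|A\|^2,\qquad L_b=\frac Kn\max_{k\in[K]}\|S^kA(S^kA)^T\| .$$ The Stochastic Acceleration (SA) factor is $\Upsilon(A,\bar S,K)=\frac{KL_f}{L_b}$. *)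

theory Defs
  imports
    "HOL-Analysis.Derivative"
    "HOL-Analysis.L2_Norm"
    "HOL-Library.Extended_Real"
    "Jordan_Normal_Form.Char_Poly"
    "Jordan_Normal_Form.DL_Submatrix"
begin

unbundle no inner_syntax and no vec_syntax

definition vec_l2 :: "real vec \<Rightarrow> real" where
  "vec_l2 v = L2_set (\<lambda>i. v $ i) {..<dim_vec v}"

definition spectral_norm :: "real mat \<Rightarrow> real" where
  "spectral_norm A = (SUP v \<in> {v \<in> carrier_vec (dim_col A). vec_l2 v \<le> 1}. vec_l2 (A *\<^sub>v v))"

text \<open>Eigenvalues are counted with multiplicity, as roots of the characteristic polynomial. A
  symmetric real matrix of size \<open>d\<close> has exactly \<open>d\<close> real roots, so for \<open>1 \<le> k \<le> d\<close> the list access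
  is then in range; \<open>k = 0\<close> and non-symmetric \<open>H\<close> are outside the intended domain.\<close>

definition eig_sigma :: "real mat \<Rightarrow> nat \<Rightarrow> real" where
  "eig_sigma H k =
     (if k > dim_row H then 0
      else rev (sorted_list_of_multiset (proots (char_poly H))) ! (k - 1))"

definition row_sampling :: "nat \<Rightarrow> nat set \<Rightarrow> real mat" where
  "row_sampling n I = submatrix (1\<^sub>m n) I UNIV"

definition gradient :: "nat \<Rightarrow> (real vec \<Rightarrow> real) \<Rightarrow> real vec \<Rightarrow> real vec" where
  "gradient d f x = vec d (\<lambda>j. deriv (\<lambda>t. f (x + t \<cdot>\<^sub>v unit_vec d j)) 0)"

text \<open>The smallest common Lipschitz constant of the gradients of a family of functions on
  d-dimensional space.\<close>

definition smoothness_const :: "nat \<Rightarrow> (real vec \<Rightarrow> real) set \<Rightarrow> real" where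
  "smoothness_const d F =
     Inf {L. 0 \<le> L \<and> (\<forall>f\<in>F. \<forall>x\<in>carrier_vec d. \<forall>y\<in>carrier_vec d.
            vec_l2 (gradient d f x - gradient d f y) \<le> L * vec_l2 (x - y))}"

definition ls_loss :: "real mat \<Rightarrow> real vec \<Rightarrow> real vec \<Rightarrow> real" where
  "ls_loss A b x = 1 / (2 * real (dim_row A)) * (vec_l2 (A *\<^sub>v x - b))\<^sup>2"

definition ls_batch_loss :: "real mat \<Rightarrow> real vec \<Rightarrow> nat \<Rightarrow> nat set \<Rightarrow> real vec \<Rightarrow> real" where
  "ls_batch_loss A b K I x =
     real K / (2 * real (dim_row A)) *
       (vec_l2 ((row_sampling (dim_row A) I * A) *\<^sub>v x - row_sampling (dim_row A) I *\<^sub>v b))\<^sup>2"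

text \<open>Rows are indexed from 0, as everywhere for the matrix type, and so are the \<open>K\<close> blocks.\<close>

definition equal_partition :: "nat \<Rightarrow> nat \<Rightarrow> (nat \<Rightarrow> nat set) \<Rightarrow> bool" where
  "equal_partition n K S \<longleftrightarrow>
     (\<Union>k<K. S k) = {..<n} \<and> disjoint_family_on S {..<K} \<and> (\<forall>k<K. card (S k) = n div K)"

definition SA_factor :: "real mat \<Rightarrow> real vec \<Rightarrow> (nat \<Rightarrow> nat set) \<Rightarrow> nat \<Rightarrow> real" where
  "SA_factor A b S K =
     real K * smoothness_const (dim_col A) {ls_loss A b} /
       smoothness_const (dim_col A) ((\<lambda>k. ls_batch_loss A b K (S k)) ` {..<K})"

text \<open>The remaining lemmas show that row sampling is taking a submatrix and that the two smoothness
  constants have the closed forms $\frac1n\|A\|^2$ and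
  $\frac Kn\max_k\|S^kA(S^kA)^T\|$.\<close>

lemma row_sampling_carrier: "row_sampling n I \<in> carrier_mat (card {i. i < n \<and> i \<in> I}) n"
  unfolding row_sampling_def carrier_mat_def by (simp add: dim_submatrix)

lemma row_sampling_mult:
  assumes A: "A \<in> carrier_mat n d"
  shows "row_sampling n I * A = submatrix A I UNIV"
proof (rule eq_matI)
  show "dim_row (row_sampling n I * A) = dim_row (submatrix A I UNIV)"
    "dim_col (row_sampling n I * A) = dim_col (submatrix A I UNIV)"
    using A row_sampling_carrier[of n I] by (auto simp: dim_submatrix)
  fix i j assume "i < dim_row (submatrix A I UNIV)" "j < dim_col (submatrix A I UNIV)"
  hence i: "i < card {i. i < n \<and> i \<in> I}" and j: "j < d" using A by (auto simp: dim_submatrix)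
  have p: "pick I i < n" using i pick_le by blast
  have "row (row_sampling n I) i = unit_vec n (pick I i)"
  proof (rule eq_vecI)
    show "dim_vec (row (row_sampling n I) i) = dim_vec (unit_vec n (pick I i) :: real vec)"
      using row_sampling_carrier[of n I] by auto
    fix l assume "l < dim_vec (unit_vec n (pick I i) :: real vec)"
    thus "row (row_sampling n I) i $ l = unit_vec n (pick I i) $ l"
      using i p row_sampling_carrier[of n I]
      by (auto simp: row_sampling_def submatrix_def pick_UNIV)
  qed
  thus "(row_sampling n I * A) $$ (i, j) = submatrix A I UNIV $$ (i, j)"
    using i j p A row_sampling_carrier[of n I] by (auto simp: submatrix_def pick_UNIV)
qed

lemma vec_l2_nonneg: "0 \<le> vec_l2 v"
  unfolding vec_l2_def by (rule L2_set_nonneg)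

lemma vec_l2_sq: "(vec_l2 v)\<^sup>2 = scalar_prod v v"
  unfolding vec_l2_def L2_set_def scalar_prod_def
  by (simp add: sum_nonneg power2_eq_square atLeast0LessThan)

lemma vec_l2_CS:
  assumes "dim_vec v = dim_vec w"
  shows "scalar_prod v w \<le> vec_l2 v * vec_l2 w"
proof -
  have "scalar_prod v w \<le> (\<Sum>i<dim_vec w. \<bar>v $ i\<bar> * \<bar>w $ i\<bar>)"
    unfolding scalar_prod_def atLeast0LessThan by (intro sum_mono) (metis abs_ge_self abs_mult)
  also have "\<dots> \<le> vec_l2 v * vec_l2 w"
    unfolding vec_l2_def assms by (rule L2_set_mult_ineq)
  finally show ?thesis .
qed

lemma vec_l2_smult: "vec_l2 (c \<cdot>\<^sub>v v) = \<bar>c\<bar> * vec_l2 v"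
proof -
  have "(vec_l2 (c \<cdot>\<^sub>v v))\<^sup>2 = (\<bar>c\<bar> * vec_l2 v)\<^sup>2"
    unfolding power_mult_distrib power2_abs vec_l2_sq by (simp add: power2_eq_square)
  thus ?thesis by (simp add: vec_l2_nonneg)
qed

lemma vec_l2_zero: "vec_l2 (0\<^sub>v n) = 0"
  unfolding vec_l2_def by (simp add: L2_set_eq_0_iff)

lemma vec_l2_mult_bound: "\<exists>C. \<forall>v\<in>carrier_vec (dim_col A). vec_l2 (A *\<^sub>v v) \<le> C * vec_l2 v"
proof (intro exI ballI)
  fix v :: "real vec" assume v: "v \<in> carrier_vec (dim_col A)"
  have le: "\<bar>row A i \<bullet> v\<bar> \<le> vec_l2 (row A i) * vec_l2 v" for i
  proof (rule abs_leI)
    show "row A i \<bullet> v \<le> vec_l2 (row A i) * vec_l2 v" by (rule vec_l2_CS) (use v in auto)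
    have "((- 1) \<cdot>\<^sub>v row A i) \<bullet> v \<le> vec_l2 ((- 1) \<cdot>\<^sub>v row A i) * vec_l2 v"
      by (rule vec_l2_CS) (use v in auto)
    thus "- (row A i \<bullet> v) \<le> vec_l2 (row A i) * vec_l2 v"
      using v by (simp add: vec_l2_smult)
  qed
  have "vec_l2 (A *\<^sub>v v) \<le> (\<Sum>i<dim_row A. \<bar>row A i \<bullet> v\<bar>)"
    unfolding vec_l2_def using L2_set_le_sum_abs[of "vec_index (A *\<^sub>v v)" "{..<dim_row A}"] by simp
  also have "\<dots> \<le> (\<Sum>i<dim_row A. vec_l2 (row A i) * vec_l2 v)" by (intro sum_mono le)
  finally show "vec_l2 (A *\<^sub>v v) \<le> (\<Sum>i<dim_row A. vec_l2 (row A i)) * vec_l2 v"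
    by (simp add: sum_distrib_right)
qed

lemma spectral_norm_bdd:
  "bdd_above ((\<lambda>v. vec_l2 (A *\<^sub>v v)) ` {v \<in> carrier_vec (dim_col A). vec_l2 v \<le> 1})"
proof -
  obtain C where C: "\<And>v. v \<in> carrier_vec (dim_col A) \<Longrightarrow> vec_l2 (A *\<^sub>v v) \<le> C * vec_l2 v"
    using vec_l2_mult_bound by blast
  have "vec_l2 (A *\<^sub>v v) \<le> \<bar>C\<bar>" if "v \<in> carrier_vec (dim_col A)" "vec_l2 v \<le> 1" for v
  proof -
    have "C * vec_l2 v \<le> \<bar>C\<bar> * 1"
      using that by (intro mult_mono) (auto simp: vec_l2_nonneg)
    thus ?thesis using C[OF that(1)] by simp
  qed
  thus ?thesis by (intro bdd_aboveI[of _ "\<bar>C\<bar>"]) auto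
qed

lemma spectral_norm_nonneg: "0 \<le> spectral_norm A"
proof -
  have "vec_l2 (A *\<^sub>v 0\<^sub>v (dim_col A)) \<le> spectral_norm A"
    unfolding spectral_norm_def by (intro cSUP_upper spectral_norm_bdd) (simp add: vec_l2_zero)
  thus ?thesis using vec_l2_nonneg order_trans by blast
qed

lemma spectral_norm_bound:
  assumes v: "v \<in> carrier_vec (dim_col A)"
  shows "vec_l2 (A *\<^sub>v v) \<le> spectral_norm A * vec_l2 v"
proof (cases "vec_l2 v = 0")
  case True
  obtain C where "vec_l2 (A *\<^sub>v v) \<le> C * vec_l2 v" using vec_l2_mult_bound v by blast
  thus ?thesis using True by simp
next
  case False
  hence pos: "vec_l2 v > 0" using vec_l2_nonneg[of v] by linarith
  define w where "w = (1 / vec_l2 v) \<cdot>\<^sub>v v"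
  have w: "w \<in> carrier_vec (dim_col A)" "vec_l2 w \<le> 1"
    using v pos by (auto simp: w_def vec_l2_smult)
  have "vec_l2 (A *\<^sub>v w) \<le> spectral_norm A"
    unfolding spectral_norm_def by (intro cSUP_upper spectral_norm_bdd) (use w in auto)
  moreover have "A *\<^sub>v w = (1 / vec_l2 v) \<cdot>\<^sub>v (A *\<^sub>v v)"
    unfolding w_def by (rule mult_mat_vec[of _ "dim_row A" "dim_col A"]) (use v in auto)
  ultimately show ?thesis using pos by (simp add: vec_l2_smult field_simps)
qed

lemma spectral_norm_least:
  assumes "0 \<le> C" "\<And>v. v \<in> carrier_vec (dim_col A) \<Longrightarrow> vec_l2 (A *\<^sub>v v) \<le> C * vec_l2 v"
  shows "spectral_norm A \<le> C"
  unfolding spectral_norm_def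
proof (rule cSUP_least)
  show "{v \<in> carrier_vec (dim_col A). vec_l2 v \<le> 1} \<noteq> {}"
    using vec_l2_zero[of "dim_col A"] zero_carrier_vec[of "dim_col A"]
    by (auto intro!: exI[of _ "0\<^sub>v (dim_col A)"])
  fix v assume "v \<in> {v \<in> carrier_vec (dim_col A). vec_l2 v \<le> 1}"
  hence "vec_l2 (A *\<^sub>v v) \<le> C * vec_l2 v" "C * vec_l2 v \<le> C"
    using assms by (auto intro: mult_left_le)
  thus "vec_l2 (A *\<^sub>v v) \<le> C" by simp
qed

lemma gram_scalar_prod:
  fixes A :: "real mat"
  assumes A: "A \<in> carrier_mat n d" and v: "v \<in> carrier_vec d" and w: "w \<in> carrier_vec n"
  shows "(A\<^sup>T *\<^sub>v w) \<bullet> v = w \<bullet> (A *\<^sub>v v)"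
  by (rule transpose_vec_mult_scalar[OF A v w])

lemma spectral_norm_transpose_le: "spectral_norm (A\<^sup>T) \<le> spectral_norm A"
proof (rule spectral_norm_least[OF spectral_norm_nonneg])
  fix w :: "real vec" assume "w \<in> carrier_vec (dim_col A\<^sup>T)"
  hence w: "w \<in> carrier_vec (dim_row A)" by simp
  define u where "u = A\<^sup>T *\<^sub>v w"
  have u: "u \<in> carrier_vec (dim_col A)" unfolding u_def by (rule carrier_vecI) simp
  have "(vec_l2 u)\<^sup>2 = w \<bullet> (A *\<^sub>v u)"
    unfolding vec_l2_sq
    using gram_scalar_prod[of A "dim_row A" "dim_col A" u w] w u by (simp add: u_def)
  also have "\<dots> \<le> vec_l2 w * vec_l2 (A *\<^sub>v u)" using w by (intro vec_l2_CS) auto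
  also have "\<dots> \<le> vec_l2 w * (spectral_norm A * vec_l2 u)"
    by (intro mult_left_mono spectral_norm_bound u vec_l2_nonneg)
  finally have "vec_l2 u * vec_l2 u \<le> (spectral_norm A * vec_l2 w) * vec_l2 u"
    by (simp add: power2_eq_square ac_simps)
  thus "vec_l2 (A\<^sup>T *\<^sub>v w) \<le> spectral_norm A * vec_l2 w"
    using vec_l2_nonneg[of u] spectral_norm_nonneg[of A] vec_l2_nonneg[of w]
    unfolding u_def[symmetric]
    by (cases "vec_l2 u = 0") (auto simp: mult_le_cancel_right)
qed

lemma spectral_norm_transpose: "spectral_norm (A\<^sup>T) = spectral_norm A"
  using spectral_norm_transpose_le[of A] spectral_norm_transpose_le[of "A\<^sup>T"] by simp

lemma spectral_norm_gram: "spectral_norm (A\<^sup>T * A) = (spectral_norm A)\<^sup>2"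
proof (rule antisym)
  show "spectral_norm (A\<^sup>T * A) \<le> (spectral_norm A)\<^sup>2"
  proof (rule spectral_norm_least)
    fix v :: "real vec" assume "v \<in> carrier_vec (dim_col (A\<^sup>T * A))"
    hence v: "v \<in> carrier_vec (dim_col A)" by simp
    have "vec_l2 ((A\<^sup>T * A) *\<^sub>v v) = vec_l2 (A\<^sup>T *\<^sub>v (A *\<^sub>v v))"
      by (subst assoc_mult_mat_vec[of _ "dim_col A" "dim_row A" _ "dim_col A"]) (use v in auto)
    also have "\<dots> \<le> spectral_norm A * vec_l2 (A *\<^sub>v v)"
      unfolding spectral_norm_transpose[of A, symmetric]
      by (rule spectral_norm_bound) (rule carrier_vecI, simp)
    also have "\<dots> \<le> spectral_norm A * (spectral_norm A * vec_l2 v)"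
      by (intro mult_left_mono spectral_norm_bound v spectral_norm_nonneg)
    finally show "vec_l2 ((A\<^sup>T * A) *\<^sub>v v) \<le> (spectral_norm A)\<^sup>2 * vec_l2 v"
      by (simp add: power2_eq_square ac_simps)
  qed simp
next
  have "spectral_norm A \<le> sqrt (spectral_norm (A\<^sup>T * A))"
  proof (rule spectral_norm_least)
    fix v :: "real vec" assume v: "v \<in> carrier_vec (dim_col A)"
    have "(vec_l2 (A *\<^sub>v v))\<^sup>2 = (A\<^sup>T *\<^sub>v (A *\<^sub>v v)) \<bullet> v"
      unfolding vec_l2_sq using v
      by (subst gram_scalar_prod[of A "dim_row A" "dim_col A"]) (auto intro: carrier_vecI)
    also have "A\<^sup>T *\<^sub>v (A *\<^sub>v v) = (A\<^sup>T * A) *\<^sub>v v"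
      by (subst assoc_mult_mat_vec[of _ "dim_col A" "dim_row A" _ "dim_col A"]) (use v in auto)
    also have "\<dots> \<bullet> v \<le> vec_l2 ((A\<^sup>T * A) *\<^sub>v v) * vec_l2 v"
      using v by (intro vec_l2_CS) auto
    also have "\<dots> \<le> (spectral_norm (A\<^sup>T * A) * vec_l2 v) * vec_l2 v"
      using v by (intro mult_right_mono spectral_norm_bound vec_l2_nonneg) auto
    finally have "(vec_l2 (A *\<^sub>v v))\<^sup>2 \<le> (sqrt (spectral_norm (A\<^sup>T * A)) * vec_l2 v)\<^sup>2"
      unfolding power_mult_distrib real_sqrt_pow2[OF spectral_norm_nonneg]
      by (simp add: power2_eq_square[of "vec_l2 v"] mult.assoc)
    thus "vec_l2 (A *\<^sub>v v) \<le> sqrt (spectral_norm (A\<^sup>T * A)) * vec_l2 v"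
      by (rule power2_le_imp_le) (simp add: vec_l2_nonneg spectral_norm_nonneg)
  qed (simp add: spectral_norm_nonneg)
  hence "(spectral_norm A)\<^sup>2 \<le> (sqrt (spectral_norm (A\<^sup>T * A)))\<^sup>2"
    by (intro power_mono spectral_norm_nonneg)
  thus "(spectral_norm A)\<^sup>2 \<le> spectral_norm (A\<^sup>T * A)" by (simp add: spectral_norm_nonneg)
qed

lemma spectral_norm_gram': "spectral_norm (A * A\<^sup>T) = (spectral_norm A)\<^sup>2"
  using spectral_norm_gram[of "A\<^sup>T"] by (simp add: spectral_norm_transpose)

lemma gradient_quadratic:
  assumes A: "A \<in> carrier_mat n d" and b: "b \<in> carrier_vec n" and x: "x \<in> carrier_vec d"
  shows "gradient d (\<lambda>x. c * (vec_l2 (A *\<^sub>v x - b))\<^sup>2) x = (2 * c) \<cdot>\<^sub>v (A\<^sup>T *\<^sub>v (A *\<^sub>v x - b))"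
proof (rule eq_vecI)
  show "dim_vec (gradient d (\<lambda>x. c * (vec_l2 (A *\<^sub>v x - b))\<^sup>2) x) =
      dim_vec ((2 * c) \<cdot>\<^sub>v (A\<^sup>T *\<^sub>v (A *\<^sub>v x - b)))"
    using A by (simp add: gradient_def)
  fix j assume "j < dim_vec ((2 * c) \<cdot>\<^sub>v (A\<^sup>T *\<^sub>v (A *\<^sub>v x - b)))"
  hence j: "j < d" using A by simp
  define r where "r = A *\<^sub>v x - b"
  define q where "q = A *\<^sub>v unit_vec d j"
  have r: "r \<in> carrier_vec n" and q: "q \<in> carrier_vec n" using A b x by (auto simp: r_def q_def)
  have eq: "A *\<^sub>v (x + t \<cdot>\<^sub>v unit_vec d j) - b = r + t \<cdot>\<^sub>v q" for t
  proof -
    have "A *\<^sub>v (x + t \<cdot>\<^sub>v unit_vec d j) = A *\<^sub>v x + t \<cdot>\<^sub>v q"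
      unfolding q_def
      by (subst mult_add_distrib_mat_vec[OF A x]) (use mult_mat_vec[OF A] in auto)
    thus ?thesis using A b x q by (intro eq_vecI) (auto simp: r_def)
  qed
  have "(vec_l2 (r + t \<cdot>\<^sub>v q))\<^sup>2 = r \<bullet> r + 2 * t * (r \<bullet> q) + t\<^sup>2 * (q \<bullet> q)" for t
    unfolding vec_l2_sq using r q comm_scalar_prod[OF q r]
    by (simp add: add_scalar_prod_distrib[of _ n] scalar_prod_add_distrib[of _ n]
        power2_eq_square algebra_simps)
  hence feq: "(\<lambda>t. c * (vec_l2 (A *\<^sub>v (x + t \<cdot>\<^sub>v unit_vec d j) - b))\<^sup>2) =
      (\<lambda>t. c * (r \<bullet> r + 2 * t * (r \<bullet> q) + t\<^sup>2 * (q \<bullet> q)))"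
    unfolding eq by simp
  have "((\<lambda>t. c * (r \<bullet> r + 2 * t * (r \<bullet> q) + t\<^sup>2 * (q \<bullet> q))) has_real_derivative
      2 * c * (r \<bullet> q)) (at 0)"
    by (auto intro!: derivative_eq_intros)
  hence "gradient d (\<lambda>x. c * (vec_l2 (A *\<^sub>v x - b))\<^sup>2) x $ j = 2 * c * (r \<bullet> q)"
    using j by (simp add: gradient_def feq DERIV_imp_deriv)
  also have "r \<bullet> q = (A\<^sup>T *\<^sub>v r) \<bullet> unit_vec d j"
    unfolding q_def using gram_scalar_prod[OF A _ r, of "unit_vec d j"] by simp
  also have "\<dots> = (A\<^sup>T *\<^sub>v r) $ j" using j A r by (subst scalar_prod_right_unit) auto
  finally show "gradient d (\<lambda>x. c * (vec_l2 (A *\<^sub>v x - b))\<^sup>2) x $ j =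
      ((2 * c) \<cdot>\<^sub>v (A\<^sup>T *\<^sub>v (A *\<^sub>v x - b))) $ j"
    using j A by (simp add: r_def)
qed

lemma gradient_quadratic_diff:
  assumes A: "A \<in> carrier_mat n d" and b: "b \<in> carrier_vec n"
    and x: "x \<in> carrier_vec d" and y: "y \<in> carrier_vec d" and c: "0 \<le> c"
  shows "vec_l2 (gradient d (\<lambda>x. c * (vec_l2 (A *\<^sub>v x - b))\<^sup>2) x -
      gradient d (\<lambda>x. c * (vec_l2 (A *\<^sub>v x - b))\<^sup>2) y) =
      2 * c * vec_l2 ((A\<^sup>T * A) *\<^sub>v (x - y))"
proof -
  have AT: "A\<^sup>T \<in> carrier_mat d n" using A by simp
  have xy: "x - y \<in> carrier_vec d" using x y by simp
  have "A *\<^sub>v (x - y) = (A *\<^sub>v x - b) - (A *\<^sub>v y - b)"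
    using A b x y by (subst mult_minus_distrib_mat_vec[OF A x y]) (intro eq_vecI, auto)
  hence "(A\<^sup>T * A) *\<^sub>v (x - y) = A\<^sup>T *\<^sub>v ((A *\<^sub>v x - b) - (A *\<^sub>v y - b))"
    by (subst assoc_mult_mat_vec[OF AT A xy]) simp
  also have "\<dots> = A\<^sup>T *\<^sub>v (A *\<^sub>v x - b) - A\<^sup>T *\<^sub>v (A *\<^sub>v y - b)"
    by (rule mult_minus_distrib_mat_vec[OF AT]) (use A b x y in auto)
  finally have "(2 * c) \<cdot>\<^sub>v ((A\<^sup>T * A) *\<^sub>v (x - y)) =
     (2 * c) \<cdot>\<^sub>v (A\<^sup>T *\<^sub>v (A *\<^sub>v x - b)) - (2 * c) \<cdot>\<^sub>v (A\<^sup>T *\<^sub>v (A *\<^sub>v y - b))"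
    using A by (intro eq_vecI) (auto simp: algebra_simps)
  thus ?thesis
    unfolding gradient_quadratic[OF A b x] gradient_quadratic[OF A b y]
    using c vec_l2_smult[of "2 * c" "(A\<^sup>T * A) *\<^sub>v (x - y)"] by simp
qed

lemma smoothness_const_quadratic:
  fixes B :: "nat \<Rightarrow> real mat"
  assumes B: "\<And>k. k < K \<Longrightarrow> B k \<in> carrier_mat (m k) d"
    and b: "\<And>k. k < K \<Longrightarrow> b k \<in> carrier_vec (m k)" and c: "0 \<le> c" and K: "K > 0"
  shows "smoothness_const d ((\<lambda>k x. c * (vec_l2 (B k *\<^sub>v x - b k))\<^sup>2) ` {..<K}) =
     2 * c * (MAX k\<in>{..<K}. spectral_norm ((B k)\<^sup>T * B k))"
proof -
  define M where "M = (MAX k\<in>{..<K}. spectral_norm ((B k)\<^sup>T * B k))"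
  have M: "spectral_norm ((B k)\<^sup>T * B k) \<le> M" if "k < K" for k
    unfolding M_def using that by (intro Max_ge) auto
  have "M \<in> (\<lambda>k. spectral_norm ((B k)\<^sup>T * B k)) ` {..<K}"
    unfolding M_def using K by (intro Max_in) auto
  then obtain k0 where k0: "k0 < K" "M = spectral_norm ((B k0)\<^sup>T * B k0)" by auto
  have M0: "0 \<le> M" using k0 spectral_norm_nonneg by simp
  let ?Q = "{L. 0 \<le> L \<and> (\<forall>f\<in>(\<lambda>k x. c * (vec_l2 (B k *\<^sub>v x - b k))\<^sup>2) ` {..<K}.
     \<forall>x\<in>carrier_vec d. \<forall>y\<in>carrier_vec d.
            vec_l2 (gradient d f x - gradient d f y) \<le> L * vec_l2 (x - y))}"
  have in_Q: "2 * c * M \<in> ?Q"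
  proof (safe)
    show "0 \<le> 2 * c * M" using c M0 by simp
    fix k and x y :: "real vec"
    assume k: "k < K" and x: "x \<in> carrier_vec d" and y: "y \<in> carrier_vec d"
    have "vec_l2 (((B k)\<^sup>T * B k) *\<^sub>v (x - y)) \<le> spectral_norm ((B k)\<^sup>T * B k) * vec_l2 (x - y)"
      using B[OF k] x y by (intro spectral_norm_bound) auto
    also have "\<dots> \<le> M * vec_l2 (x - y)" by (intro mult_right_mono M k vec_l2_nonneg)
    finally have "2 * c * vec_l2 (((B k)\<^sup>T * B k) *\<^sub>v (x - y)) \<le> 2 * c * (M * vec_l2 (x - y))"
      using c by (intro mult_left_mono) auto
    thus "vec_l2 (gradient d (\<lambda>x. c * (vec_l2 (B k *\<^sub>v x - b k))\<^sup>2) x -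
        gradient d (\<lambda>x. c * (vec_l2 (B k *\<^sub>v x - b k))\<^sup>2) y) \<le> 2 * c * M * vec_l2 (x - y)"
      unfolding gradient_quadratic_diff[OF B[OF k] b[OF k] x y c] by (simp add: ac_simps)
  qed
  have le_Q: "2 * c * M \<le> L" if L: "L \<in> ?Q" for L
  proof (cases "c = 0")
    case True
    thus ?thesis using L by simp
  next
    case False
    hence c': "c > 0" using c by simp
    have "spectral_norm ((B k0)\<^sup>T * B k0) \<le> L / (2 * c)"
    proof (rule spectral_norm_least)
      show "0 \<le> L / (2 * c)" using L c by simp
      fix v :: "real vec" assume "v \<in> carrier_vec (dim_col ((B k0)\<^sup>T * B k0))"
      hence v: "v \<in> carrier_vec d" using B[OF k0(1)] by simp
      have z: "0\<^sub>v d \<in> carrier_vec d" by simp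
      have v0: "v - 0\<^sub>v d = v" using v by simp
      have "vec_l2 (gradient d (\<lambda>x. c * (vec_l2 (B k0 *\<^sub>v x - b k0))\<^sup>2) v -
        gradient d (\<lambda>x. c * (vec_l2 (B k0 *\<^sub>v x - b k0))\<^sup>2) (0\<^sub>v d)) \<le> L * vec_l2 (v - 0\<^sub>v d)"
        using L k0(1) v z by blast
      hence "2 * c * vec_l2 (((B k0)\<^sup>T * B k0) *\<^sub>v v) \<le> L * vec_l2 v"
        unfolding gradient_quadratic_diff[OF B[OF k0(1)] b[OF k0(1)] v z c] v0 .
      thus "vec_l2 (((B k0)\<^sup>T * B k0) *\<^sub>v v) \<le> L / (2 * c) * vec_l2 v"
        using c' by (simp add: field_simps)
    qed
    thus ?thesis using c' k0 by (simp add: field_simps)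
  qed
  show ?thesis
    unfolding smoothness_const_def M_def[symmetric]
    by (rule cInf_eq_minimum[OF in_Q le_Q])
qed

lemma smoothness_const_ls_loss:
  assumes A: "A \<in> carrier_mat n d" and b: "b \<in> carrier_vec n"
  shows "smoothness_const d {ls_loss A b} = 1 / real n * (spectral_norm A)\<^sup>2"
proof -
  have "ls_loss A b = (\<lambda>x. 1 / (2 * real n) * (vec_l2 (A *\<^sub>v x - b))\<^sup>2)"
    using A by (auto simp: ls_loss_def fun_eq_iff)
  thus ?thesis
    using smoothness_const_quadratic[of 1 "\<lambda>_. A" "\<lambda>_. n" d "\<lambda>_. b" "1 / (2 * real n)"] A b
    by (simp add: spectral_norm_gram lessThan_Suc)
qed

lemma smoothness_const_ls_batch_loss:
  assumes A: "A \<in> carrier_mat n d" and b: "b \<in> carrier_vec n" and K: "K > 0"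
  shows "smoothness_const d ((\<lambda>k. ls_batch_loss A b K (S k)) ` {..<K}) =
     real K / real n * (MAX k\<in>{..<K}. spectral_norm
       ((row_sampling n (S k) * A) * (row_sampling n (S k) * A)\<^sup>T))"
proof -
  let ?m = "\<lambda>k. card {i. i < n \<and> i \<in> S k}"
  let ?R = "\<lambda>k. row_sampling n (S k)"
  have R: "?R k \<in> carrier_mat (?m k) n" for k by (rule row_sampling_carrier)
  have fam: "(\<lambda>k. ls_batch_loss A b K (S k)) =
     (\<lambda>k x. real K / (2 * real n) * (vec_l2 ((?R k * A) *\<^sub>v x - ?R k *\<^sub>v b))\<^sup>2)"
    using A by (auto simp: ls_batch_loss_def fun_eq_iff)
  have "smoothness_const d ((\<lambda>k. ls_batch_loss A b K (S k)) ` {..<K}) =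
     2 * (real K / (2 * real n)) * (MAX k\<in>{..<K}. spectral_norm ((?R k * A)\<^sup>T * (?R k * A)))"
    unfolding fam
  proof (rule smoothness_const_quadratic[of K _ ?m])
    show "?R k * A \<in> carrier_mat (?m k) d" for k by (rule mult_carrier_mat[OF R A])
    show "?R k *\<^sub>v b \<in> carrier_vec (?m k)" for k by (rule mult_mat_vec_carrier[OF R b])
  qed (use K in auto)
  thus ?thesis by (simp add: spectral_norm_gram spectral_norm_gram')
qed

lemma SA_factor_closed_form:
  assumes A: "A \<in> carrier_mat n d" and b: "b \<in> carrier_vec n" and K: "K > 0"
  shows "SA_factor A b S K =
     real K * (1 / real n * (spectral_norm A)\<^sup>2) /
       (real K / real n * (MAX k\<in>{..<K}. spectral_norm
         (submatrix A (S k) UNIV * (submatrix A (S k) UNIV)\<^sup>T)))"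
  using A smoothness_const_ls_loss[OF A b] smoothness_const_ls_batch_loss[OF A b K, of S]
  by (simp add: SA_factor_def row_sampling_mult[OF A])

end

theory Submission
  imports Defs
begin

text \<open>Since \<open>\<Upsilon> = \<parallel>A\<parallel>\<^sup>2 / max\<^sub>k \<parallel>S\<^sup>kA\<parallel>\<^sup>2\<close>, it suffices that every block of \<open>m = n/K\<close> rows satisfies
  \<open>\<sigma>(A\<^sup>TA, n - m + 1) \<le> \<parallel>S\<^sup>kA\<parallel>\<^sup>2\<close>. The span of the leading \<open>n - m + 1\<close> eigenvectors of \<open>A\<^sup>TA\<close>
  contains a vector \<open>x \<noteq> 0\<close> annihilated by the remaining \<open>n - m\<close> rows, and for it
  \<open>\<sigma>(A\<^sup>TA, n - m + 1) \<parallel>x\<parallel>\<^sup>2 \<le> \<parallel>Ax\<parallel>\<^sup>2 = \<parallel>S\<^sup>kAx\<parallel>\<^sup>2\<close>. The eigenbasis comes from the spectral theorem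
  for real symmetric matrices, proved by deflation with Householder reflections.\<close>

section \<open>Real roots of symmetric characteristic polynomials\<close>

lemma scalar_prod_self_eq_0:
  fixes v :: "real vec"
  assumes "v \<in> carrier_vec n" "v \<bullet> v = 0"
  shows "v = 0\<^sub>v n"
  using conjugate_square_eq_0_vec[OF assms(1)] assms(2)
  by (simp add: conjugate_vec_def map_vec_def)

text \<open>Split an eigenvector into real and imaginary parts \<open>x\<close> and
  \<open>y\<close>. Comparing \<open>(A *\<^sub>v x) \<bullet> y\<close> with
  \<open>x \<bullet> (A *\<^sub>v y)\<close>, equal by symmetry, leaves
  \<open>Im z * (x \<bullet> x + y \<bullet> y) = 0\<close>, and the second factor is
  nonzero.\<close>

lemma symmetric_complex_eigenvalue_real:
  fixes A :: "real mat"
  assumes A: "A \<in> carrier_mat n n" and sym: "A\<^sup>T = A"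
    and ev: "eigenvalue (map_mat complex_of_real A) z"
  shows "Im z = 0"
proof -
  obtain v where v: "v \<in> carrier_vec n" "v \<noteq> 0\<^sub>v n"
    and Av: "map_mat complex_of_real A *\<^sub>v v = z \<cdot>\<^sub>v v"
    using ev A unfolding eigenvalue_def eigenvector_def by auto
  define x y where "x = map_vec Re v" and "y = map_vec Im v"
  have x: "x \<in> carrier_vec n" and y: "y \<in> carrier_vec n" using v by (auto simp: x_def y_def)
  have comp: "(\<Sum>j<n. complex_of_real (A $$ (i, j)) * v $ j) = z * v $ i" if "i < n" for i
    using arg_cong[OF Av, of "\<lambda>u. u $ i"] that A v by (simp add: scalar_prod_def atLeast0LessThan)
  have Ax: "A *\<^sub>v x = Re z \<cdot>\<^sub>v x - Im z \<cdot>\<^sub>v y"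
  proof (rule eq_vecI)
    fix i assume "i < dim_vec (Re z \<cdot>\<^sub>v x - Im z \<cdot>\<^sub>v y)"
    hence i: "i < n" using y by simp
    show "(A *\<^sub>v x) $ i = (Re z \<cdot>\<^sub>v x - Im z \<cdot>\<^sub>v y) $ i"
      using arg_cong[OF comp[OF i], of Re] i A v
      by (simp add: scalar_prod_def atLeast0LessThan x_def y_def)
  qed (use A y in auto)
  have Ay: "A *\<^sub>v y = Re z \<cdot>\<^sub>v y + Im z \<cdot>\<^sub>v x"
  proof (rule eq_vecI)
    fix i assume "i < dim_vec (Re z \<cdot>\<^sub>v y + Im z \<cdot>\<^sub>v x)"
    hence i: "i < n" using x by simp
    show "(A *\<^sub>v y) $ i = (Re z \<cdot>\<^sub>v y + Im z \<cdot>\<^sub>v x) $ i"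
      using arg_cong[OF comp[OF i], of Im] i A v
      by (simp add: scalar_prod_def atLeast0LessThan x_def y_def)
  qed (use A x in auto)
  have "(A *\<^sub>v x) \<bullet> y = x \<bullet> (A *\<^sub>v y)"
    using transpose_vec_mult_scalar[OF A y x] sym by simp
  hence "Im z * (x \<bullet> x + y \<bullet> y) = 0"
    unfolding Ax Ay using x y comm_scalar_prod[OF x y]
    by (simp add: minus_scalar_prod_distrib[of _ n] scalar_prod_add_distrib[of _ n] algebra_simps)
  moreover have "x \<bullet> x + y \<bullet> y \<noteq> 0"
  proof
    assume "x \<bullet> x + y \<bullet> y = 0"
    hence "x \<bullet> x = 0" "y \<bullet> y = 0"
      using zero_le_power2[of "vec_l2 x"] zero_le_power2[of "vec_l2 y"] unfolding vec_l2_sq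
      by linarith+
    hence "x = 0\<^sub>v n" "y = 0\<^sub>v n" using scalar_prod_self_eq_0 x y by blast+
    hence "x $ i = 0" "y $ i = 0" if "i < n" for i using that by simp_all
    hence "v $ i = 0" if "i < n" for i
      using that v by (simp add: x_def y_def complex_eq_iff)
    thus False using v by (auto intro: eq_vecI)
  qed
  ultimately show ?thesis by simp
qed

text \<open>The polynomial splits over the complex numbers and all its roots there are real, so the
  factorization pulls back along the injective embedding of the reals.\<close>

lemma char_poly_symmetric_splits:
  fixes A :: "real mat"
  assumes A: "A \<in> carrier_mat n n" and sym: "A\<^sup>T = A"
  shows "\<exists>es. char_poly A = (\<Prod>e\<leftarrow>es. [:- e, 1:]) \<and> length es = n"
proof -
  let ?h = "complex_of_real"
  interpret h: map_poly_inj_idom_hom ?h by unfold_locales auto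
  have hA: "map_mat ?h A \<in> carrier_mat n n" using A by simp
  obtain as where as: "char_poly (map_mat ?h A) = (\<Prod>a\<leftarrow>as. [:- a, 1:])" "length as = n"
    using char_poly_factorized[OF hA] by blast
  have real: "?h (Re a) = a" if "a \<in> set as" for a
  proof -
    have "poly (char_poly (map_mat ?h A)) a = 0"
      unfolding as(1) using that by (auto simp: poly_prod_list prod_list_zero_iff)
    hence "eigenvalue (map_mat ?h A) a" using eigenvalue_root_char_poly[OF hA] by simp
    thus ?thesis using symmetric_complex_eigenvalue_real[OF A sym] by (simp add: complex_eq_iff)
  qed
  have "map_poly ?h (char_poly A) = (\<Prod>a\<leftarrow>as. [:- a, 1:])"
    unfolding as(1)[symmetric] by (rule of_real_hom.char_poly_hom[OF A, symmetric])
  also have "\<dots> = (\<Prod>a\<leftarrow>as. map_poly ?h [:- Re a, 1:])"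
    by (rule arg_cong[of _ _ prod_list], rule map_cong) (use real in auto)
  also have "\<dots> = map_poly ?h (\<Prod>e\<leftarrow>map Re as. [:- e, 1:])"
    by (simp add: h.hom_prod_list o_def)
  finally have "char_poly A = (\<Prod>e\<leftarrow>map Re as. [:- e, 1:])" by simp
  thus ?thesis using as(2) by (intro exI[of _ "map Re as"]) simp
qed

text \<open>Links a list of linear factors to the root multiset from which \<open>eig_sigma\<close>
  is read.\<close>

lemma proots_prod_linear: "proots (\<Prod>e\<leftarrow>es. [:- e, 1:]) = mset (es :: 'a :: idom list)"
proof (induction es)
  case (Cons e es)
  have "(\<Prod>e\<leftarrow>es. [:- e, 1:]) \<noteq> 0" by (auto simp: prod_list_zero_iff)
  hence "proots ([:- e, 1:] * (\<Prod>e\<leftarrow>es. [:- e, 1:])) = {#e#} + mset es"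
    using Cons by (subst proots_mult) auto
  thus ?case by simp
qed simp

section \<open>Orthogonal diagonalization by Householder deflation\<close>

text \<open>The reflection in the hyperplane orthogonal to \<open>w = v - unit_vec (Suc n) 0\<close>
  exchanges these two vectors, as both have length 1. For \<open>w = 0\<close> there is no such
  hyperplane, and the identity serves instead.\<close>

lemma orthogonal_reflection_exists:
  fixes v :: "real vec"
  assumes v: "v \<in> carrier_vec (Suc n)" and unit: "v \<bullet> v = 1"
  shows "\<exists>W \<in> carrier_mat (Suc n) (Suc n). W\<^sup>T = W \<and> W * W = 1\<^sub>m (Suc n) \<and>
    W *\<^sub>v v = unit_vec (Suc n) 0"
proof (cases "v = unit_vec (Suc n) 0")
  case True
  thus ?thesis by (intro bexI[of _ "1\<^sub>m (Suc n)"]) auto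
next
  case False
  define w where "w = v - unit_vec (Suc n) 0"
  \<comment> \<open>The Householder matrix: identity minus \<open>2 / (w \<bullet> w)\<close> times
    the outer product of \<open>w\<close> with itself.\<close>
  define W where "W = mat (Suc n) (Suc n)
    (\<lambda>(i, j). (if i = j then 1 else 0) - 2 / (w \<bullet> w) * (w $ i) * (w $ j))"
  have w: "w \<in> carrier_vec (Suc n)" using v by (simp add: w_def)
  have W: "W \<in> carrier_mat (Suc n) (Suc n)" by (simp add: W_def)
  have w0: "w \<bullet> w \<noteq> 0"
  proof
    assume "w \<bullet> w = 0"
    hence "w = 0\<^sub>v (Suc n)" using scalar_prod_self_eq_0[OF w] by simp
    hence "w $ i = 0" if "i < Suc n" for i using that by simp
    hence "v = unit_vec (Suc n) 0" using v by (intro eq_vecI) (auto simp: w_def)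
    thus False using False by simp
  qed
  have Wu: "W *\<^sub>v u = u - (2 / (w \<bullet> w) * (w \<bullet> u)) \<cdot>\<^sub>v w" if u: "u \<in> carrier_vec (Suc n)" for u
  proof (rule eq_vecI)
    fix i assume "i < dim_vec (u - (2 / (w \<bullet> w) * (w \<bullet> u)) \<cdot>\<^sub>v w)"
    hence i: "i < Suc n" using w by simp
    have "(W *\<^sub>v u) $ i = (\<Sum>j<Suc n. ((if i = j then 1 else 0) - 2 / (w \<bullet> w) * w $ i * w $ j) * u $ j)"
      using i u by (simp add: W_def scalar_prod_def atLeast0LessThan)
    also have "\<dots> = (\<Sum>j<Suc n. (if i = j then u $ j else 0) - 2 / (w \<bullet> w) * w $ i * (w $ j * u $ j))"
      by (intro sum.cong) (auto simp: algebra_simps)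
    also have "\<dots> = u $ i - 2 / (w \<bullet> w) * w $ i * (w \<bullet> u)"
      using i u unfolding sum_subtractf sum_distrib_left[symmetric]
      by (simp add: scalar_prod_def atLeast0LessThan del: sum.lessThan_Suc)
    finally show "(W *\<^sub>v u) $ i = (u - (2 / (w \<bullet> w) * (w \<bullet> u)) \<cdot>\<^sub>v w) $ i"
      using i u w by simp
  qed (use W w u in auto)
  have "W\<^sup>T = W" by (rule eq_matI) (auto simp: W_def)
  \<comment> \<open>Compared column by column: column \<open>j\<close> is \<open>W\<close> applied
    twice to a unit vector \<open>u\<close>. The first application flips the sign of
    \<open>w \<bullet> u\<close>, so the second one undoes it.\<close>
  moreover have "W * W = 1\<^sub>m (Suc n)"
  proof (rule mat_col_eqI)
    fix j assume "j < dim_col (1\<^sub>m (Suc n) :: real mat)"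
    hence j: "j < Suc n" by simp
    define u where "u = (unit_vec (Suc n) j :: real vec)"
    have u: "u \<in> carrier_vec (Suc n)" by (simp add: u_def)
    let ?c = "2 / (w \<bullet> w) * (w \<bullet> u)"
    have "col (W * W) j = W *\<^sub>v (W *\<^sub>v u)"
    proof -
      have "col (W * W * 1\<^sub>m (Suc n)) j = (W * W) *\<^sub>v col (1\<^sub>m (Suc n)) j"
        by (rule col_mult2) (use W j in auto)
      thus ?thesis using W j assoc_mult_mat_vec[OF W W u] by (simp add: u_def)
    qed
    also have "\<dots> = u"
    proof -
      have "w \<bullet> (u - ?c \<cdot>\<^sub>v w) = - (w \<bullet> u)"
        using u w w0 by (simp add: scalar_prod_minus_distrib[of _ "Suc n"])
      thus ?thesis using u w by (subst Wu, simp add: Wu, subst Wu) (auto intro!: eq_vecI simp: Wu)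
    qed
    finally show "col (W * W) j = col (1\<^sub>m (Suc n)) j" using j by (simp add: u_def)
  qed (use W in auto)
  moreover have "W *\<^sub>v v = unit_vec (Suc n) 0"
  proof -
    \<comment> \<open>Since \<open>v\<close> has length 1, \<open>w \<bullet> w\<close> is twice
      \<open>w \<bullet> v\<close>; the coefficient of \<open>w\<close> is then 1 and
      \<open>W *\<^sub>v v = v - w\<close>.\<close>
    have "w \<bullet> w = 2 - 2 * v $ 0" "w \<bullet> v = 1 - v $ 0"
      using v unit by (simp_all add: w_def minus_scalar_prod_distrib[of _ "Suc n"]
        scalar_prod_minus_distrib[of _ "Suc n"])
    hence "2 / (w \<bullet> w) * (w \<bullet> v) = 1" using w0 by (simp add: field_simps)
    thus ?thesis unfolding Wu[OF v] using v by (intro eq_vecI) (auto simp: w_def)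
  qed
  ultimately show ?thesis using W by blast
qed

text \<open>Induction on the roots: a reflection moves a unit eigenvector for the first root onto
  the first axis, symmetry splits off a 1-by-1 block, and the induction hypothesis treats the rest.
  The order of \<open>es\<close> is kept, so a sorted list yields ordered eigenvectors.\<close>

lemma symmetric_orthogonal_diagonalization:
  fixes A :: "real mat"
  assumes "A \<in> carrier_mat n n" and "A\<^sup>T = A"
    and "char_poly A = (\<Prod>e\<leftarrow>es. [:- e, 1:])"
  shows "\<exists>U \<in> carrier_mat n n. U\<^sup>T * U = 1\<^sub>m n \<and> A * U = U * mat_diag n (\<lambda>i. es ! i)"
  using assms
proof (induction es arbitrary: n A)
  case Nil
  hence "n = 0" using degree_monic_char_poly[of A n] by simp
  thus ?case using Nil by (intro bexI[of _ "1\<^sub>m n"]) (auto simp: mat_diag_def intro!: eq_matI)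
next
  case (Cons e es N A)
  let ?p = "\<Prod>e\<leftarrow>es. [:- e, 1:] :: real poly"
  have A: "A \<in> carrier_mat N N" and sym: "A\<^sup>T = A"
    and cp: "char_poly A = [:- e, 1:] * ?p" using Cons.prems by simp_all
  have "?p \<noteq> 0" by (auto simp: prod_list_zero_iff)
  \<comment> \<open>Degrees are compared only to see that the dimension \<open>N\<close> is
    positive.\<close>
  hence "degree (char_poly A) = Suc (degree ?p)" unfolding cp by (subst degree_mult_eq) auto
  then obtain n where N: "N = Suc n" using degree_monic_char_poly[OF A] by simp
  have A: "A \<in> carrier_mat (Suc n) (Suc n)" using A N by simp
  have "eigenvalue A e" unfolding eigenvalue_root_char_poly[OF A] cp by simp
  then obtain u where u: "u \<in> carrier_vec (Suc n)" "u \<noteq> 0\<^sub>v (Suc n)" "A *\<^sub>v u = e \<cdot>\<^sub>v u"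
    using A unfolding eigenvalue_def eigenvector_def by auto
  have "u \<bullet> u \<noteq> 0" using scalar_prod_self_eq_0 u by blast
  hence nu: "vec_l2 u \<noteq> 0" "u \<bullet> u = vec_l2 u * vec_l2 u"
    using vec_l2_sq[of u] by (auto simp: power2_eq_square)
  define v where "v = (1 / vec_l2 u) \<cdot>\<^sub>v u"
  have v: "v \<in> carrier_vec (Suc n)" "v \<bullet> v = 1" "A *\<^sub>v v = e \<cdot>\<^sub>v v"
    using u nu A by (auto simp: v_def mult_mat_vec[OF A] smult_smult_assoc mult.commute)
  obtain W where W: "W \<in> carrier_mat (Suc n) (Suc n)" and symW: "W\<^sup>T = W"
    and WW: "W * W = 1\<^sub>m (Suc n)" and Wv: "W *\<^sub>v v = unit_vec (Suc n) 0"
    using orthogonal_reflection_exists[OF v(1,2)] by blast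
  \<comment> \<open>\<open>W\<close> is its own inverse and transpose, so \<open>A'\<close> is both
    similar to \<open>A\<close> and symmetric.\<close>
  define A' where "A' = W * A * W"
  have A': "A' \<in> carrier_mat (Suc n) (Suc n)" using W A by (simp add: A'_def)
  have symA': "A'\<^sup>T = A'"
    unfolding A'_def
    using transpose_mult[of "W * A" "Suc n" "Suc n" W "Suc n"] transpose_mult[OF W A]
      assoc_mult_mat[OF W A W] W A sym symW
    by simp
  have "W *\<^sub>v unit_vec (Suc n) 0 = v"
    unfolding Wv[symmetric] using assoc_mult_mat_vec[OF W W v(1)] WW v(1) by simp
  hence "A' *\<^sub>v unit_vec (Suc n) 0 = e \<cdot>\<^sub>v unit_vec (Suc n) 0"
    unfolding A'_def
    using assoc_mult_mat_vec[of "W * A" "Suc n" "Suc n" W "Suc n" "unit_vec (Suc n) 0"]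
      assoc_mult_mat_vec[OF W A v(1)] mult_mat_vec[OF W v(1), of e] W A v(3) Wv
    by simp
  moreover have "A' *\<^sub>v unit_vec (Suc n) 0 = col A' 0"
    using col_mult2[OF A' one_carrier_mat, of 0] A' by simp
  ultimately have col: "col A' 0 = e \<cdot>\<^sub>v unit_vec (Suc n) 0" by simp
  have c0: "A' $$ (i, 0) = (if i = 0 then e else 0)" if "i < Suc n" for i
    using arg_cong[OF col, of "\<lambda>u. u $ i"] that A' by auto
  \<comment> \<open>Symmetry carries the zeros of the first column over to the first row, which
    makes \<open>A'\<close> block diagonal.\<close>
  have r0: "A' $$ (0, i) = (if i = 0 then e else 0)" if "i < Suc n" for i
    using arg_cong[OF symA', of "\<lambda>M. M $$ (0, i)"] c0[OF that] that A' by simp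
  define E where "E = mat 1 1 (\<lambda>_. e)"
  define B where "B = mat n n (\<lambda>(i, j). A' $$ (Suc i, Suc j))"
  have B: "B \<in> carrier_mat n n" and E: "E \<in> carrier_mat 1 1" by (simp_all add: B_def E_def)
  have block: "A' = four_block_mat E (0\<^sub>m 1 n) (0\<^sub>m n 1) B"
    by (rule eq_matI) (use A' c0 r0 in \<open>auto simp: E_def B_def\<close>)
  have symB: "B\<^sup>T = B"
  proof (rule eq_matI)
    fix i j assume "i < dim_row B" "j < dim_col B"
    thus "B\<^sup>T $$ (i, j) = B $$ (i, j)"
      using arg_cong[OF symA', of "\<lambda>M. M $$ (Suc i, Suc j)"] A' by (simp add: B_def)
  qed (use B in auto)
  \<comment> \<open>Similarity preserves the characteristic polynomial; cancelling the factor of the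
    block \<open>E\<close> leaves for \<open>B\<close> the product that the induction hypothesis
    requires.\<close>
  have "similar_mat A' A"
    unfolding similar_mat_def
    by (intro exI[of _ W] similar_mat_witI[OF WW WW A'_def A' A W W])
  hence "char_poly E * char_poly B = [:- e, 1:] * ?p"
    using char_poly_similar cp char_poly_four_block_zeros_col[OF E zero_carrier_mat B, folded block]
    by metis
  moreover have "char_poly E = [:- e, 1:]" by (simp add: E_def char_poly_defs det_def sign_def)
  ultimately have "char_poly B = ?p" by (metis mult_cancel_left pCons_eq_0_iff zero_neq_one)
  from Cons.IH[OF B symB this] obtain P where P: "P \<in> carrier_mat n n" and PP: "P\<^sup>T * P = 1\<^sub>m n"
    and BP: "B * P = P * mat_diag n (\<lambda>i. es ! i)" by blast
  \<comment> \<open>\<open>V\<close> extends \<open>P\<close> by a fixed first axis and diagonalizes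
    \<open>A'\<close>; the matrix sought is \<open>W * V\<close>.\<close>
  define V where "V = four_block_mat (1\<^sub>m 1) (0\<^sub>m 1 n) (0\<^sub>m n 1) P"
  define D where "D = mat_diag (Suc n) (\<lambda>i. (e # es) ! i)"
  have V: "V \<in> carrier_mat (Suc n) (Suc n)" and D: "D \<in> carrier_mat (Suc n) (Suc n)"
    using P by (auto simp: V_def D_def)
  have Dblock: "D = four_block_mat E (0\<^sub>m 1 n) (0\<^sub>m n 1) (mat_diag n (\<lambda>i. es ! i))"
    by (rule eq_matI) (auto simp: D_def E_def mat_diag_def nth_Cons')
  have VT: "V\<^sup>T = four_block_mat (1\<^sub>m 1) (0\<^sub>m 1 n) (0\<^sub>m n 1) P\<^sup>T"
    unfolding V_def by (subst transpose_four_block_mat[OF _ _ _ P, of _ 1 1]) auto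
  have VV: "V\<^sup>T * V = 1\<^sub>m (Suc n)"
    unfolding VT unfolding V_def
    by (subst mult_four_block_mat[of _ 1 1 _ n _ n _ _ 1 _ n]) (use P PP in auto)
  have "A' * V = four_block_mat E (0\<^sub>m 1 n) (0\<^sub>m n 1) (B * P)"
    unfolding block V_def
    by (subst mult_four_block_mat[of _ 1 1 _ n _ n _ _ 1 _ n]) (use P B E in auto)
  moreover have "V * D = four_block_mat E (0\<^sub>m 1 n) (0\<^sub>m n 1) (P * mat_diag n (\<lambda>i. es ! i))"
    unfolding Dblock V_def
    by (subst mult_four_block_mat[of _ 1 1 _ n _ n _ _ 1 _ n])
      (use P E in \<open>auto simp: left_mult_zero_mat[OF mat_diag_dim]\<close>)
  ultimately have A'V: "A' * V = V * D" by (simp add: BP)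
  have "W * A' = W * W * A * W"
    unfolding A'_def assoc_mult_mat[OF W W A]
    by (rule assoc_mult_mat[OF W mult_carrier_mat[OF W A] W, symmetric])
  hence AW: "A * W = W * A'" using A WW by simp
  have "(W * V)\<^sup>T * (W * V) = V\<^sup>T * (W * (W * V))"
    unfolding transpose_mult[OF W V] symW
    by (rule assoc_mult_mat[of _ "Suc n" "Suc n"]) (use V W in auto)
  also have "W * (W * V) = W * W * V" by (rule assoc_mult_mat[OF W W V, symmetric])
  finally have "(W * V)\<^sup>T * (W * V) = V\<^sup>T * (W * W * V)" .
  hence "(W * V)\<^sup>T * (W * V) = 1\<^sub>m (Suc n)" using V VV WW by simp
  moreover have "A * (W * V) = (W * V) * D"
    using assoc_mult_mat[OF A W V] assoc_mult_mat[OF W A' V] assoc_mult_mat[OF W V D] AW A'V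
    by metis
  ultimately show ?case unfolding N D_def using W V by (intro bexI[of _ "W * V"]) auto
qed

section \<open>Kernel vectors and the spectral decomposition of Gram matrices\<close>

text \<open>Padding \<open>C\<close> with zero rows to a square matrix makes the determinant
  vanish.\<close>

lemma exists_nonzero_kernel_vec:
  fixes C :: "'a :: field mat"
  assumes C: "C \<in> carrier_mat r c" and "r < c"
  shows "\<exists>v \<in> carrier_vec c. v \<noteq> 0\<^sub>v c \<and> C *\<^sub>v v = 0\<^sub>v r"
proof -
  \<comment> \<open>Row \<open>r\<close>, which exists because \<open>r < c\<close>, is singled out
    as a zero row to fit the form of \<open>det_row_0\<close>.\<close>
  define M where "M = mat\<^sub>r c c (\<lambda>i. if i = r then 0\<^sub>v c else if i < r then row C i else 0\<^sub>v c)"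
  have "det M = 0"
    unfolding M_def by (rule det_row_0) (use assms in auto)
  moreover have M: "M \<in> carrier_mat c c" by (simp add: M_def)
  ultimately obtain v where v: "v \<in> carrier_vec c" "v \<noteq> 0\<^sub>v c" "M *\<^sub>v v = 0\<^sub>v c"
    using det_0_iff_vec_prod_zero_field by blast
  have "row C i \<bullet> v = 0" if "i < r" for i
    using arg_cong[OF v(3), of "\<lambda>u. u $ i"] that \<open>r < c\<close> C v(1)
    by (simp add: M_def row_mat_of_row_fun)
  hence "C *\<^sub>v v = 0\<^sub>v r" using C by (intro eq_vecI) auto
  thus ?thesis using v by blast
qed

lemma symmetric_spectral_decomposition:
  fixes H :: "real mat"
  assumes H: "H \<in> carrier_mat d d" and sym: "H\<^sup>T = H"
  obtains U where "U \<in> carrier_mat d d" "U\<^sup>T * U = 1\<^sub>m d"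
    "H * U = U * mat_diag d (\<lambda>i. eig_sigma H (Suc i))"
    "\<And>i j. i \<le> j \<Longrightarrow> j < d \<Longrightarrow> eig_sigma H (Suc j) \<le> eig_sigma H (Suc i)"
proof -
  obtain es where es: "char_poly H = (\<Prod>e\<leftarrow>es. [:- e, 1:])" "length es = d"
    using char_poly_symmetric_splits[OF H sym] by blast
  define fs where "fs = rev (sort es)"
  have fs: "rev (sorted_list_of_multiset (proots (char_poly H))) = fs"
    unfolding es(1) proots_prod_linear by (simp add: fs_def)
  have eig: "eig_sigma H (Suc i) = fs ! i" if "i < d" for i
    using H that unfolding eig_sigma_def fs by simp
  \<comment> \<open>The product of linear factors ignores their order, so the diagonalization can be
    run on the decreasing list \<open>fs\<close>.\<close>
  have "mset fs = mset es" by (simp add: fs_def)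
  hence "char_poly H = (\<Prod>e\<leftarrow>fs. [:- e, 1:])"
    unfolding es(1) by (metis mset_map prod_mset_prod_list)
  from symmetric_orthogonal_diagonalization[OF H sym this] obtain U where
    U: "U \<in> carrier_mat d d" "U\<^sup>T * U = 1\<^sub>m d" "H * U = U * mat_diag d (\<lambda>i. fs ! i)" by blast
  have "mat_diag d (\<lambda>i. fs ! i) = mat_diag d (\<lambda>i. eig_sigma H (Suc i))"
    by (rule eq_matI) (auto simp: mat_diag_def eig)
  moreover have "fs ! j \<le> fs ! i" if "i \<le> j" "j < d" for i j
    using that es(2) by (auto simp: fs_def rev_nth intro!: sorted_nth_mono)
  ultimately show thesis using that[of U] U eig by simp
qed

text \<open>In eigenvector coordinates \<open>y\<close> both squared norms become sums of squares,
  weighted by the eigenvalues for \<open>A\<close>. This holds because the squared norm of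
  \<open>A *\<^sub>v x\<close> is the quadratic form of \<open>A\<^sup>T * A\<close> at
  \<open>x\<close>.\<close>

lemma gram_spectral_decomposition:
  fixes A :: "real mat"
  assumes A: "A \<in> carrier_mat n d"
  defines "\<sigma> \<equiv> \<lambda>i. eig_sigma (A\<^sup>T * A) (Suc i)"
  obtains U where "U \<in> carrier_mat d d" "U\<^sup>T * U = 1\<^sub>m d"
    "\<And>y. y \<in> carrier_vec d \<Longrightarrow> (vec_l2 (U *\<^sub>v y))\<^sup>2 = (\<Sum>i<d. (y $ i)\<^sup>2)"
    "\<And>y. y \<in> carrier_vec d \<Longrightarrow> (vec_l2 (A *\<^sub>v (U *\<^sub>v y)))\<^sup>2 = (\<Sum>i<d. \<sigma> i * (y $ i)\<^sup>2)"
    "\<And>i j. i \<le> j \<Longrightarrow> j < d \<Longrightarrow> \<sigma> j \<le> \<sigma> i"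
proof -
  define H where "H = A\<^sup>T * A"
  have H: "H \<in> carrier_mat d d" using A by (simp add: H_def)
  have sym: "H\<^sup>T = H" using transpose_mult[of "A\<^sup>T" d n A d] A by (simp add: H_def)
  obtain U where U: "U \<in> carrier_mat d d" and UU: "U\<^sup>T * U = 1\<^sub>m d"
    and HU: "H * U = U * mat_diag d \<sigma>"
    and mono: "\<And>i j. i \<le> j \<Longrightarrow> j < d \<Longrightarrow> \<sigma> j \<le> \<sigma> i"
    using symmetric_spectral_decomposition[OF H sym] unfolding \<sigma>_def H_def by blast
  have UUv: "U\<^sup>T *\<^sub>v (U *\<^sub>v z) = z" if "z \<in> carrier_vec d" for z
    using assoc_mult_mat_vec[of "U\<^sup>T" d d U d z] U UU that by simp
  have 1: "(vec_l2 (U *\<^sub>v y))\<^sup>2 = (\<Sum>i<d. (y $ i)\<^sup>2)" if y: "y \<in> carrier_vec d" for y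
  proof -
    have "(vec_l2 (U *\<^sub>v y))\<^sup>2 = (U\<^sup>T *\<^sub>v (U *\<^sub>v y)) \<bullet> y"
      unfolding vec_l2_sq using gram_scalar_prod[OF U y, of "U *\<^sub>v y"] U y by simp
    thus ?thesis using y UUv[OF y] by (simp add: scalar_prod_def atLeast0LessThan power2_eq_square)
  qed
  have 2: "(vec_l2 (A *\<^sub>v (U *\<^sub>v y)))\<^sup>2 = (\<Sum>i<d. \<sigma> i * (y $ i)\<^sup>2)" if y: "y \<in> carrier_vec d" for y
  proof -
    define z where "z = mat_diag d \<sigma> *\<^sub>v y"
    have z: "z \<in> carrier_vec d" unfolding z_def by (rule mult_mat_vec_carrier[OF mat_diag_dim y])
    have Uy: "U *\<^sub>v y \<in> carrier_vec d" using U y by simp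
    have zi: "z $ i = \<sigma> i * y $ i" if "i < d" for i
      using that y
      by (auto simp: z_def mat_diag_def scalar_prod_def if_distrib[of "\<lambda>c. c * _"] cong: if_cong)
    have "(vec_l2 (A *\<^sub>v (U *\<^sub>v y)))\<^sup>2 = (A\<^sup>T *\<^sub>v (A *\<^sub>v (U *\<^sub>v y))) \<bullet> (U *\<^sub>v y)"
      unfolding vec_l2_sq using gram_scalar_prod[OF A Uy, of "A *\<^sub>v (U *\<^sub>v y)"] A Uy by simp
    also have "A\<^sup>T *\<^sub>v (A *\<^sub>v (U *\<^sub>v y)) = H *\<^sub>v (U *\<^sub>v y)"
      unfolding H_def using assoc_mult_mat_vec[of "A\<^sup>T" d n A d "U *\<^sub>v y"] A Uy by simp
    also have "\<dots> = U *\<^sub>v z"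
      unfolding z_def using assoc_mult_mat_vec[OF H U y] HU
        assoc_mult_mat_vec[OF U mat_diag_dim y] by simp
    also have "(U *\<^sub>v z) \<bullet> (U *\<^sub>v y) = (U\<^sup>T *\<^sub>v (U *\<^sub>v z)) \<bullet> y"
      using gram_scalar_prod[OF U y, of "U *\<^sub>v z"] U z by simp
    also have "\<dots> = (\<Sum>i<d. \<sigma> i * (y $ i)\<^sup>2)"
      using y zi UUv[OF z]
      by (simp add: scalar_prod_def atLeast0LessThan power2_eq_square mult.assoc)
    finally show ?thesis .
  qed
  show thesis using that[OF U UU 1 2 mono] by blast
qed

text \<open>An eigenvalue is the squared norm of \<open>A\<close> applied to its unit eigenvector;
  beyond \<open>d\<close> it is 0 by convention.\<close>

lemma gram_eig_sigma_nonneg: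
  assumes A: "A \<in> carrier_mat n d"
  shows "0 \<le> eig_sigma (A\<^sup>T * A) (Suc i)"
proof (cases "i < d")
  case True
  obtain U where U: "\<And>y. y \<in> carrier_vec d \<Longrightarrow>
      (vec_l2 (A *\<^sub>v (U *\<^sub>v y)))\<^sup>2 = (\<Sum>i<d. eig_sigma (A\<^sup>T * A) (Suc i) * (y $ i)\<^sup>2)"
    using gram_spectral_decomposition[OF A] by metis
  have "(\<Sum>j<d. eig_sigma (A\<^sup>T * A) (Suc j) * ((unit_vec d i :: real vec) $ j)\<^sup>2)
      = (\<Sum>j<d. if j = i then eig_sigma (A\<^sup>T * A) (Suc j) else 0)"
    by (intro sum.cong) (use True in auto)
  hence "eig_sigma (A\<^sup>T * A) (Suc i) = (vec_l2 (A *\<^sub>v (U *\<^sub>v unit_vec d i)))\<^sup>2"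
    using U[of "unit_vec d i"] True by simp
  thus ?thesis by simp
next
  case False
  thus ?thesis using A by (simp add: eig_sigma_def)
qed

text \<open>In eigenvector coordinates every weight is at most the leading eigenvalue.\<close>

lemma spectral_norm_sq_le_eig_sigma:
  assumes A: "A \<in> carrier_mat n d" and "d > 0"
  shows "(spectral_norm A)\<^sup>2 \<le> eig_sigma (A\<^sup>T * A) 1"
proof -
  define p where "p = eig_sigma (A\<^sup>T * A) (Suc 0)"
  have p: "0 \<le> p" unfolding p_def by (rule gram_eig_sigma_nonneg[OF A])
  obtain U where U: "U \<in> carrier_mat d d" "U\<^sup>T * U = 1\<^sub>m d"
    and l2: "\<And>y. y \<in> carrier_vec d \<Longrightarrow> (vec_l2 (U *\<^sub>v y))\<^sup>2 = (\<Sum>i<d. (y $ i)\<^sup>2)"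
    "\<And>y. y \<in> carrier_vec d \<Longrightarrow>
      (vec_l2 (A *\<^sub>v (U *\<^sub>v y)))\<^sup>2 = (\<Sum>i<d. eig_sigma (A\<^sup>T * A) (Suc i) * (y $ i)\<^sup>2)"
    and mono: "\<And>i j. i \<le> j \<Longrightarrow> j < d \<Longrightarrow>
      eig_sigma (A\<^sup>T * A) (Suc j) \<le> eig_sigma (A\<^sup>T * A) (Suc i)"
    by (rule gram_spectral_decomposition[OF A]) blast
  \<comment> \<open>A left inverse of a square matrix is a right inverse, so every \<open>v\<close>
    has coordinates \<open>U\<^sup>T *\<^sub>v v\<close>.\<close>
  have "U * U\<^sup>T = 1\<^sub>m d" using mat_mult_left_right_inverse[of "U\<^sup>T" d U] U by simp
  have "spectral_norm A \<le> sqrt p"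
  proof (rule spectral_norm_least)
    fix v :: "real vec" assume "v \<in> carrier_vec (dim_col A)"
    hence v: "v \<in> carrier_vec d" using A by simp
    define y where "y = U\<^sup>T *\<^sub>v v"
    have y: "y \<in> carrier_vec d" using U by (simp add: y_def carrier_vecI)
    have vy: "U *\<^sub>v y = v"
      unfolding y_def using assoc_mult_mat_vec[of U d d "U\<^sup>T" d v] U v \<open>U * U\<^sup>T = 1\<^sub>m d\<close> by simp
    have "(vec_l2 (A *\<^sub>v v))\<^sup>2 \<le> (\<Sum>i<d. p * (y $ i)\<^sup>2)"
      using l2(2)[OF y] unfolding vy by (auto simp: p_def intro!: sum_mono mult_right_mono mono)
    also have "\<dots> = (sqrt p * vec_l2 v)\<^sup>2"
      using l2(1)[OF y] p unfolding vy by (simp add: power_mult_distrib sum_distrib_left)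
    finally show "vec_l2 (A *\<^sub>v v) \<le> sqrt p * vec_l2 v"
      by (rule power2_le_imp_le) (simp add: p vec_l2_nonneg)
  qed (simp add: p)
  hence "(spectral_norm A)\<^sup>2 \<le> (sqrt p)\<^sup>2" by (intro power_mono spectral_norm_nonneg)
  thus ?thesis using p by (simp add: p_def)
qed

section \<open>Eigenvalue bounds from blocks of rows\<close>

text \<open>\<open>pick I\<close> enumerates \<open>I\<close> bijectively, so the entries of the
  product with the submatrix are those of \<open>A *\<^sub>v x\<close> at the indices in
  \<open>I\<close>, and the sum is reindexed.\<close>

lemma vec_l2_submatrix_sq:
  assumes A: "A \<in> carrier_mat n d" and I: "I \<subseteq> {..<n}" and x: "x \<in> carrier_vec d"
  shows "(vec_l2 (submatrix A I UNIV *\<^sub>v x))\<^sup>2 = (\<Sum>i\<in>I. ((A *\<^sub>v x) $ i)\<^sup>2)"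
proof -
  have fin: "finite I" using I finite_subset by blast
  have Iset: "{i. i < n \<and> i \<in> I} = I" using I by auto
  have pick: "pick I r \<in> I" if "r < card I" for r using that by (rule pick_in_set_le)
  have inj: "inj_on (pick I) {..<card I}"
    by (rule inj_onI) (metis lessThan_iff linorder_neqE_nat nat_less_le pick_mono_le)
  have img: "pick I ` {..<card I} = I"
    by (rule card_subset_eq[OF fin]) (use pick inj in \<open>auto simp: card_image\<close>)
  have "(submatrix A I UNIV *\<^sub>v x) $ r = (A *\<^sub>v x) $ pick I r" if r: "r < card I" for r
  proof -
    have "pick I r < n" using pick[OF r] I by auto
    thus ?thesis using r A x Iset
      by (simp add: submatrix_def pick_UNIV scalar_prod_def)
  qed
  moreover have "dim_row (submatrix A I UNIV) = card I" using A Iset by (simp add: dim_submatrix)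
  ultimately have "(vec_l2 (submatrix A I UNIV *\<^sub>v x))\<^sup>2 = (\<Sum>r<card I. ((A *\<^sub>v x) $ pick I r)\<^sup>2)"
    unfolding vec_l2_def L2_set_def by (simp add: sum_nonneg)
  also have "\<dots> = (\<Sum>i\<in>pick I ` {..<card I}. ((A *\<^sub>v x) $ i)\<^sup>2)"
    by (simp add: sum.reindex[OF inj])
  finally show ?thesis by (simp only: img)
qed

text \<open>A dimension count as in the Courant-Fischer principle: the rows outside \<open>I\<close>
  impose \<open>n - card I\<close> linear conditions on a combination of one more leading
  eigenvectors.\<close>

lemma eig_sigma_le_spectral_norm_submatrix_sq:
  assumes A: "A \<in> carrier_mat n d" and I: "I \<subseteq> {..<n}"
  shows "eig_sigma (A\<^sup>T * A) (Suc (n - card I)) \<le> (spectral_norm (submatrix A I UNIV))\<^sup>2"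
proof (cases "n - card I < d")
  \<comment> \<open>The index exceeds \<open>d\<close> here, so the left-hand side is 0 by
    convention.\<close>
  case False
  thus ?thesis using A by (simp add: eig_sigma_def)
next
  case True
  define j where "j = n - card I"
  define q where "q = eig_sigma (A\<^sup>T * A) (Suc j)"
  have j: "j < d" using True by (simp add: j_def)
  define R where "R = submatrix A ({..<n} - I) UNIV"
  have "{i. i < n \<and> i \<notin> I} = {..<n} - I" by auto
  hence "card {i. i < n \<and> i \<notin> I} = j"
    using I by (simp add: j_def card_Diff_subset finite_subset)
  hence R: "R \<in> carrier_mat j d"
    using A by (intro carrier_matI) (simp_all add: R_def dim_submatrix)
  obtain U where U: "U \<in> carrier_mat d d"
    and l2: "\<And>y. y \<in> carrier_vec d \<Longrightarrow> (vec_l2 (U *\<^sub>v y))\<^sup>2 = (\<Sum>i<d. (y $ i)\<^sup>2)"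
    "\<And>y. y \<in> carrier_vec d \<Longrightarrow>
      (vec_l2 (A *\<^sub>v (U *\<^sub>v y)))\<^sup>2 = (\<Sum>i<d. eig_sigma (A\<^sup>T * A) (Suc i) * (y $ i)\<^sup>2)"
    and mono: "\<And>i j. i \<le> j \<Longrightarrow> j < d \<Longrightarrow>
      eig_sigma (A\<^sup>T * A) (Suc j) \<le> eig_sigma (A\<^sup>T * A) (Suc i)"
    by (rule gram_spectral_decomposition[OF A]) blast
  \<comment> \<open>\<open>T\<close> embeds the first \<open>j + 1\<close> coordinates into
    \<open>d\<close>-space, so the range of \<open>U * T\<close> is the span of the leading
    \<open>j + 1\<close> eigenvectors.\<close>
  define T where "T = mat d (Suc j) (\<lambda>(i, k). if i = k then 1 else 0 :: real)"
  have T: "T \<in> carrier_mat d (Suc j)" by (simp add: T_def)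
  have "R * U * T \<in> carrier_mat j (Suc j)" using R U T by simp
  then obtain v where v: "v \<in> carrier_vec (Suc j)" "v \<noteq> 0\<^sub>v (Suc j)" "(R * U * T) *\<^sub>v v = 0\<^sub>v j"
    using exists_nonzero_kernel_vec by blast
  define y where "y = T *\<^sub>v v"
  define x where "x = U *\<^sub>v y"
  have y: "y \<in> carrier_vec d" using T v by (simp add: y_def)
  have x: "x \<in> carrier_vec d" using U y by (simp add: x_def)
  have yi: "y $ i = (if i \<le> j then v $ i else 0)" if "i < d" for i
    using that v(1)
    by (auto simp: y_def T_def scalar_prod_def if_distrib[of "\<lambda>c. c * _"] cong: if_cong)
  have "R *\<^sub>v x = 0\<^sub>v j"
    using v(1,3) assoc_mult_mat_vec[of "R * U" j d T "Suc j" v] assoc_mult_mat_vec[OF R U y] R U T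
    by (simp add: x_def y_def)
  \<comment> \<open>The rows outside \<open>I\<close> contribute nothing to the norm of
    \<open>A *\<^sub>v x\<close>, so only the block \<open>I\<close> remains.\<close>
  hence "(\<Sum>i\<in>{..<n} - I. ((A *\<^sub>v x) $ i)\<^sup>2) = 0"
    using vec_l2_submatrix_sq[OF A _ x, of "{..<n} - I"] by (simp add: R_def vec_l2_zero)
  hence "(vec_l2 (A *\<^sub>v x))\<^sup>2 = (\<Sum>i\<in>I. ((A *\<^sub>v x) $ i)\<^sup>2)"
    using sum.subset_diff[OF I, of "\<lambda>i. ((A *\<^sub>v x) $ i)\<^sup>2"] A
    by (simp add: vec_l2_def L2_set_def sum_nonneg)
  also have "\<dots> = (vec_l2 (submatrix A I UNIV *\<^sub>v x))\<^sup>2"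
    using vec_l2_submatrix_sq[OF A I x] by simp
  also have "\<dots> \<le> (spectral_norm (submatrix A I UNIV) * vec_l2 x)\<^sup>2"
  proof -
    have "x \<in> carrier_vec (dim_col (submatrix A I UNIV))" using A x by (simp add: dim_submatrix)
    thus ?thesis by (intro power_mono spectral_norm_bound vec_l2_nonneg)
  qed
  finally have upper: "(vec_l2 (A *\<^sub>v x))\<^sup>2 \<le> (spectral_norm (submatrix A I UNIV))\<^sup>2 * (vec_l2 x)\<^sup>2"
    by (simp add: power_mult_distrib)
  have "q * (vec_l2 x)\<^sup>2 = (\<Sum>i<d. q * (y $ i)\<^sup>2)"
    using l2(1)[OF y] by (simp add: x_def sum_distrib_left)
  \<comment> \<open>Coordinates beyond \<open>j\<close> vanish; for the others the eigenvalue is at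
    least \<open>q\<close>, the last one in the span.\<close>
  also have "\<dots> \<le> (vec_l2 (A *\<^sub>v x))\<^sup>2"
    unfolding x_def l2(2)[OF y] by (intro sum_mono) (auto simp: yi q_def j intro!: mult_right_mono mono)
  finally have "q * (vec_l2 x)\<^sup>2 \<le> (spectral_norm (submatrix A I UNIV))\<^sup>2 * (vec_l2 x)\<^sup>2"
    using upper by simp
  \<comment> \<open>Needed to cancel the norm of \<open>x\<close>: \<open>U\<close> is an isometry
    and \<open>y\<close> is the nonzero \<open>v\<close> padded with zeros.\<close>
  moreover have "(vec_l2 x)\<^sup>2 > 0"
  proof -
    have "\<exists>i \<le> j. v $ i \<noteq> 0"
    proof (rule ccontr)
      assume "\<not> (\<exists>i \<le> j. v $ i \<noteq> 0)"
      hence "v = 0\<^sub>v (Suc j)" using v(1) by (intro eq_vecI) auto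
      thus False using v(2) by simp
    qed
    then obtain i where "i \<le> j" "v $ i \<noteq> 0" by blast
    hence i: "i < d" "y $ i \<noteq> 0" using j yi by auto
    have "0 < (\<Sum>i<d. (y $ i)\<^sup>2)" using i by (intro sum_pos2[of _ i]) auto
    thus ?thesis using l2(1)[OF y] by (simp add: x_def)
  qed
  ultimately show ?thesis by (simp add: q_def j_def)
qed

section \<open>The bound on the Stochastic Acceleration factor\<close>

theorem theorem4p16:
  fixes A :: "real mat" and b :: "real vec" and n d K :: nat and S :: "nat \<Rightarrow> nat set"
  assumes "A \<in> carrier_mat n d" and "A \<noteq> 0\<^sub>m n d"
    and "b \<in> carrier_vec n"
    and "K > 0" and "K dvd n"
    and "equal_partition n K S"
  shows "ereal (SA_factor A b S K) \<le>
    (let p = eig_sigma (A\<^sup>T * A) 1;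
         q = eig_sigma (A\<^sup>T * A) (nat \<lfloor>real n - real n / real K + 1\<rfloor>)
     in if q = 0 then \<infinity> else ereal (p / q))"
proof -
  note A = assms(1) and b = assms(3) and K = assms(4)
  have nd: "n > 0" "d > 0" using A assms(2) by (auto intro!: gr0I eq_matI)
  define B where "B = (\<lambda>k. submatrix A (S k) UNIV)"
  define M where "M = (MAX k\<in>{..<K}. spectral_norm (B k * (B k)\<^sup>T))"
  define p where "p = eig_sigma (A\<^sup>T * A) 1"
  define q where "q = eig_sigma (A\<^sup>T * A) (Suc (n - n div K))"
  \<comment> \<open>As \<open>K\<close> divides \<open>n\<close>, the argument of the floor is
    already the integer \<open>n - m + 1\<close> with \<open>m = n div K\<close>.\<close>
  have idx: "nat \<lfloor>real n - real n / real K + 1\<rfloor> = Suc (n - n div K)"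
  proof -
    have "real n - real n / real K + 1 = real (Suc (n - n div K))"
      using real_of_nat_div[OF assms(5)] by (simp add: of_nat_diff)
    thus ?thesis by (simp only: floor_of_nat nat_int)
  qed
  \<comment> \<open>One block suffices to bound the maximum \<open>M\<close> from below; block 0
    exists since \<open>K > 0\<close>.\<close>
  have S0: "S 0 \<subseteq> {..<n}" "card (S 0) = n div K"
    using assms(4,6) unfolding equal_partition_def by blast+
  have "q \<le> (spectral_norm (B 0))\<^sup>2"
    using eig_sigma_le_spectral_norm_submatrix_sq[OF A S0(1)] S0(2) by (simp add: q_def B_def)
  also have "\<dots> \<le> M"
    unfolding spectral_norm_gram'[symmetric] M_def using K by (intro Max_ge) auto
  finally have qM: "q \<le> M" .
  have q0: "0 \<le> q" unfolding q_def by (rule gram_eig_sigma_nonneg[OF A])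
  have p: "(spectral_norm A)\<^sup>2 \<le> p"
    unfolding p_def by (rule spectral_norm_sq_le_eig_sigma[OF A nd(2)])
  \<comment> \<open>The factors \<open>K\<close> and \<open>1 / n\<close> cancel in the closed
    form.\<close>
  have SA: "SA_factor A b S K = (spectral_norm A)\<^sup>2 / M"
    using SA_factor_closed_form[OF A b K, of S] nd K by (simp add: M_def B_def)
  \<comment> \<open>A nonzero \<open>q\<close> is positive, hence so is \<open>M\<close>, and the
    fractions compare termwise; for \<open>q = 0\<close> the bound is infinite.\<close>
  have "SA_factor A b S K \<le> p / q" if "q \<noteq> 0"
    unfolding SA using that q0 qM p order_trans[OF zero_le_power2 p] by (intro frac_le) auto
  thus ?thesis unfolding idx by (simp add: Let_def p_def q_def)
qed

end
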